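(* Let $N\ge1$, let $x_n>0$ and $y_n>0$ for $n=1,\dots,N$, and for each $n$ let $C_n:[0,\infty)\to\mathbb{R}$ be a quasiconvex and non-decreasing function with $C_n(0)=0$. On the set $F=\{\boldsymbol\lambda\in\mathbb{R}^N:\lambda_n>0\ \forall n,\ \sum_{j}\lambda_jx_j<1\}$ define $$A_n(\boldsymbol\lambda)=\frac{1}{\lambda_n}+x_n+\frac{\sum_j\lambda_jy_j}{2(1-\sum_j\lambda_jx_j)},\qquad B_n(\boldsymbol\lambda)=2\max\left(\frac1{\lambda_n}+x_n,\ \frac{\sum_j\lambda_jy_j}{2(1-\sum_j\lambda_jx_j)}\right),$$ and $C_{\mathrm{sys}}(\boldsymbol\lambda)=\max_nC_n(A_n(\boldsymbol\lambda))$. Let $\boldsymbol\lambda^*$ be an optimal solution of the original problem $\min_{\boldsymbol\lambda\in F}\max_nC_n(A_n(\boldsymbol\lambda))$, and let $A_n^*=A_n(\boldsymbol\lambda^* )$. Let $\boldsymbol\lambda_B^*$ be an optimal solution of the approximation problem $\min_{\boldsymbol\lambda\in F}\max_nC_n(B_n(\boldsymbol\lambda))$. Define $$\beta_n\triangleq\inf\{\beta:\ |C_n(a_1)-C_n(a_2)|\le\beta|a_1-a_2|\ \ \forall\,a_1,a_2\}.$$ Then $$C_{\mathrm{sys}}(\boldsymbol\lambda^* )\le C_{\mathrm{sys}}(\boldsymbol\lambda^*_B)\le C_{\mathrm{sys}}(\boldsymbol\lambda^* )+\max_n\beta_nA_n^*.$$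
   Context: Here $\lambda_n$ is the update rate, $x_n$ and $y_n$ the mean and second moment of the service time, and $C_n$ the cost function of entity $n$; $A_n(\boldsymbol\lambda)$ is the peak age-of-information of entity $n$ in the multi-class $M/G/1$ queue. All indices range over $\{1,\dots,N\}$. The infimum of the empty set is $+\infty$ (in which case the upper bound is trivial). *)

theory Defs
  imports "HOL-Analysis.Analysis"
begin

definition quasiconvex_on :: "'a::real_vector set \<Rightarrow> ('a \<Rightarrow> real) \<Rightarrow> bool" where
  "quasiconvex_on S f \<longleftrightarrow> convex S \<and>
     (\<forall>a\<in>S. \<forall>b\<in>S. \<forall>t\<in>{0..1}. f ((1 - t) *\<^sub>R a + t *\<^sub>R b) \<le> max (f a) (f b))"

definition feasible :: "real^'n \<Rightarrow> (real^'n) set" where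
  "feasible x = {l. (\<forall>n. l $ n > 0) \<and> (\<Sum>j\<in>UNIV. l $ j * x $ j) < 1}"

definition peak_age :: "real^'n \<Rightarrow> real^'n \<Rightarrow> real^'n \<Rightarrow> 'n \<Rightarrow> real" where
  "peak_age x y l n = 1 / l $ n + x $ n
     + (\<Sum>j\<in>UNIV. l $ j * y $ j) / (2 * (1 - (\<Sum>j\<in>UNIV. l $ j * x $ j)))"

definition approx_age :: "real^'n \<Rightarrow> real^'n \<Rightarrow> real^'n \<Rightarrow> 'n \<Rightarrow> real" where
  "approx_age x y l n = 2 * max (1 / l $ n + x $ n)
     ((\<Sum>j\<in>UNIV. l $ j * y $ j) / (2 * (1 - (\<Sum>j\<in>UNIV. l $ j * x $ j))))"

definition sys_cost :: "('n::finite \<Rightarrow> real \<Rightarrow> real) \<Rightarrow> real^'n \<Rightarrow> real^'n \<Rightarrow> real^'n \<Rightarrow> real" where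
  "sys_cost C x y l = (MAX n. C n (peak_age x y l n))"

definition approx_sys_cost :: "('n::finite \<Rightarrow> real \<Rightarrow> real) \<Rightarrow> real^'n \<Rightarrow> real^'n \<Rightarrow> real^'n \<Rightarrow> real" where
  "approx_sys_cost C x y l = (MAX n. C n (approx_age x y l n))"

text \<open>The infimum is taken in the extended reals, so it is \<open>\<infinity>\<close> when \<open>f\<close> is not Lipschitz
  on \<open>S\<close> (\<open>Inf\<close> of the empty set of reals would be unspecified).\<close>

definition best_lipschitz :: "real set \<Rightarrow> (real \<Rightarrow> real) \<Rightarrow> ereal" where
  "best_lipschitz S f =
     Inf {ereal \<beta> | \<beta>. \<forall>a\<^sub>1\<in>S. \<forall>a\<^sub>2\<in>S. \<bar>f a\<^sub>1 - f a\<^sub>2\<bar> \<le> \<beta> * \<bar>a\<^sub>1 - a\<^sub>2\<bar>}"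

end

theory Submission
  imports Defs
begin

text \<open>
  The peak age has the form \<open>p + q\<close> and its surrogate the form \<open>2 * max p q\<close>, with the same
  nonnegative \<open>p\<close> and \<open>q\<close>. Hence \<open>A \<le> B \<le> 2 * A\<close> for every feasible rate vector. The costs being
  monotone, the first inequality bounds the true cost of the surrogate optimum \<open>\<lambda>\<^sub>B\<close> by its surrogate
  cost, and minimality bounds the latter by the surrogate cost of the true optimum \<open>\<lambda>\<close>:
  \<open>max\<^sub>n C\<^sub>n (A\<^sub>n \<lambda>\<^sub>B) \<le> max\<^sub>n C\<^sub>n (B\<^sub>n \<lambda>\<^sub>B) \<le> max\<^sub>n C\<^sub>n (B\<^sub>n \<lambda>)\<close>.
  By the second inequality, replacing \<open>A\<^sub>n \<lambda>\<close> by \<open>B\<^sub>n \<lambda>\<close> moves the argument of \<open>C\<^sub>n\<close> up by at most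
  \<open>A\<^sub>n \<lambda>\<close>, so the cost grows by at most \<open>\<beta>\<^sub>n * A\<^sub>n \<lambda>\<close> (lemma \<open>best_lipschitz_bound\<close>).
  The lower estimate on the cost of \<open>\<lambda>\<^sub>B\<close> is the optimality of \<open>\<lambda>\<close>.
\<close>

text \<open>
  The infimum of the admissible constants is itself admissible, because for fixed \<open>a \<noteq> b\<close> each of them
  is at least the difference quotient of \<open>f\<close>. For \<open>a = b\<close> the right-hand side is \<open>0\<close> even if the
  constant is \<open>\<infinity>\<close>, by the convention \<open>\<infinity> * 0 = 0\<close> of the extended reals.
\<close>

lemma best_lipschitz_bound:
  assumes "a \<in> S" and "b \<in> S"
  shows "ereal \<bar>f a - f b\<bar> \<le> best_lipschitz S f * ereal \<bar>a - b\<bar>"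
proof (cases "a = b")
  case True
  then show ?thesis by (simp flip: zero_ereal_def)
next
  case False
  then have pos: "\<bar>a - b\<bar> > 0" by simp
  have "ereal (\<bar>f a - f b\<bar> / \<bar>a - b\<bar>) \<le> best_lipschitz S f"
    unfolding best_lipschitz_def
    using assms pos by (auto intro!: Inf_greatest simp: divide_le_eq)
  then have "ereal (\<bar>f a - f b\<bar> / \<bar>a - b\<bar>) * ereal \<bar>a - b\<bar> \<le> best_lipschitz S f * ereal \<bar>a - b\<bar>"
    by (intro ereal_mult_right_mono) simp_all
  then show ?thesis using pos by simp
qed

lemma ages_pos:
  assumes "\<And>n. x $ n > 0" and "\<And>n. y $ n > 0" and "l \<in> feasible x"
  shows "1 / l $ n + x $ n > 0"
    and "(\<Sum>j\<in>UNIV. l $ j * y $ j) / (2 * (1 - (\<Sum>j\<in>UNIV. l $ j * x $ j))) \<ge> 0"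
proof -
  have l: "\<And>n. l $ n > 0" and load: "(\<Sum>j\<in>UNIV. l $ j * x $ j) < 1"
    using assms(3) by (auto simp: feasible_def)
  show "1 / l $ n + x $ n > 0"
    using l assms(1) by (intro add_pos_pos) simp_all
  have "(\<Sum>j\<in>UNIV. l $ j * y $ j) \<ge> 0"
    using l assms(2) by (intro sum_nonneg mult_nonneg_nonneg) (simp_all add: less_imp_le)
  then show "(\<Sum>j\<in>UNIV. l $ j * y $ j) / (2 * (1 - (\<Sum>j\<in>UNIV. l $ j * x $ j))) \<ge> 0"
    using load by (intro divide_nonneg_nonneg) simp_all
qed

lemma approx_age_between:
  assumes "\<And>n. x $ n > 0" and "\<And>n. y $ n > 0" and "l \<in> feasible x"
  shows "peak_age x y l n > 0"
    and "peak_age x y l n \<le> approx_age x y l n"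
    and "approx_age x y l n \<le> 2 * peak_age x y l n"
proof -
  have sum_max: "p + q > 0 \<and> p + q \<le> 2 * max p q \<and> 2 * max p q \<le> 2 * (p + q)"
    if "p > 0" and "q \<ge> 0" for p q :: real
    using that by (auto simp: max_def)
  note age = sum_max[OF ages_pos(1)[OF assms, of n] ages_pos(2)[OF assms]]
  show "peak_age x y l n > 0"
    and "peak_age x y l n \<le> approx_age x y l n"
    and "approx_age x y l n \<le> 2 * peak_age x y l n"
    unfolding peak_age_def approx_age_def using age by blast+
qed

lemma sys_cost_le_approx_sys_cost:
  assumes "\<And>n. x $ n > 0" and "\<And>n. y $ n > 0" and "l \<in> feasible x"
    and "\<And>n. mono_on {0..} (C n)"
  shows "sys_cost C x y l \<le> approx_sys_cost C x y l"
proof -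
  have "C n (peak_age x y l n) \<le> approx_sys_cost C x y l" for n
  proof -
    have "C n (peak_age x y l n) \<le> C n (approx_age x y l n)"
      using approx_age_between[OF assms(1-3), of n]
      by (intro mono_onD[OF assms(4)]) auto
    also have "\<dots> \<le> approx_sys_cost C x y l"
      unfolding approx_sys_cost_def by (rule Max_ge) auto
    finally show ?thesis .
  qed
  then show ?thesis unfolding sys_cost_def by (subst Max_le_iff) auto
qed

text \<open>
  The gap between surrogate and true cost at a single rate vector: the argument \<open>2 * A\<^sub>n\<close>
  lies at distance exactly \<open>A\<^sub>n\<close> from \<open>A\<^sub>n\<close>, which is why \<open>A\<^sub>n\<close> is the factor of the
  Lipschitz constant.
\<close>

lemma approx_sys_cost_le:
  assumes "\<And>n. x $ n > 0" and "\<And>n. y $ n > 0" and "l \<in> feasible x"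
    and "\<And>n. mono_on {0..} (C n)"
  shows "ereal (approx_sys_cost C x y l) \<le> ereal (sys_cost C x y l)
    + (MAX n. best_lipschitz {0..} (C n) * ereal (peak_age x y l n))"
proof -
  have "approx_sys_cost C x y l \<in> range (\<lambda>n. C n (approx_age x y l n))"
    unfolding approx_sys_cost_def by (rule Max_in) auto
  then obtain n where n: "approx_sys_cost C x y l = C n (approx_age x y l n)" by auto
  let ?A = "peak_age x y l n"
  note age = approx_age_between[OF assms(1-3), of n]
  have "C n (approx_age x y l n) \<le> C n (2 * ?A)"
    using age by (intro mono_onD[OF assms(4)]) auto
  then have "ereal (C n (approx_age x y l n)) \<le> ereal (C n ?A) + ereal \<bar>C n (2 * ?A) - C n ?A\<bar>"
    by simp
  also have "\<dots> \<le> ereal (C n ?A) + best_lipschitz {0..} (C n) * ereal ?A"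
    using best_lipschitz_bound[of "2 * ?A" "{0..}" ?A "C n"] age(1)
    by (intro add_left_mono) simp
  also have "\<dots> \<le> ereal (sys_cost C x y l)
      + (MAX n. best_lipschitz {0..} (C n) * ereal (peak_age x y l n))"
  proof (rule add_mono)
    show "ereal (C n ?A) \<le> ereal (sys_cost C x y l)"
      unfolding sys_cost_def ereal_less_eq by (rule Max_ge) auto
    show "best_lipschitz {0..} (C n) * ereal ?A
        \<le> (MAX n. best_lipschitz {0..} (C n) * ereal (peak_age x y l n))"
      by (rule Max_ge) auto
  qed
  finally show ?thesis by (simp add: n)
qed

theorem lemma4:
  fixes x y :: "real^'n" and C :: "'n \<Rightarrow> real \<Rightarrow> real"
    and lopt lB :: "real^'n"
  assumes x_pos: "\<And>n. x $ n > 0"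
    and y_pos: "\<And>n. y $ n > 0"
    and quasiconvex: "\<And>n. quasiconvex_on {0..} (C n)"
    and nondecreasing: "\<And>n. mono_on {0..} (C n)"
    and C_zero: "\<And>n. C n 0 = 0"
    and lopt: "is_arg_min (sys_cost C x y) (\<lambda>l. l \<in> feasible x) lopt"
    and lB: "is_arg_min (approx_sys_cost C x y) (\<lambda>l. l \<in> feasible x) lB"
  shows "sys_cost C x y lopt \<le> sys_cost C x y lB \<and>
    ereal (sys_cost C x y lB)
      \<le> ereal (sys_cost C x y lopt)
        + (MAX n. best_lipschitz {0..} (C n) * ereal (peak_age x y lopt n))"
proof
  have feas: "lopt \<in> feasible x" "lB \<in> feasible x"
    using lopt lB by (auto simp: is_arg_min_def)
  show "sys_cost C x y lopt \<le> sys_cost C x y lB"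
    using lopt feas(2) by (auto simp: is_arg_min_linorder)
  have "sys_cost C x y lB \<le> approx_sys_cost C x y lB"
    by (rule sys_cost_le_approx_sys_cost[OF x_pos y_pos feas(2) nondecreasing])
  also have "\<dots> \<le> approx_sys_cost C x y lopt"
    using lB feas(1) by (auto simp: is_arg_min_linorder)
  finally have "ereal (sys_cost C x y lB) \<le> ereal (approx_sys_cost C x y lopt)"
    by simp
  also note approx_sys_cost_le[OF x_pos y_pos feas(1) nondecreasing]
  finally show "ereal (sys_cost C x y lB) \<le> ereal (sys_cost C x y lopt)
      + (MAX n. best_lipschitz {0..} (C n) * ereal (peak_age x y lopt n))" .
qed

end
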